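(* Let $n\ge 2$, let $K=[0,\infty)^n\subset\mathbb{R}^n$ be the non-negative orthant, and let $A=(a_1,a_2,\dots,a_n)$ with $0<a_1\le a_2\le\dots\le a_n$. Then the length of a shortest segment cut from $K$ by a line through $A$ is equal to $(a_1^{2/3}+a_2^{2/3})^{3/2}$; that is, the minimum of the length of $\ell\cap K$ over all lines $\ell$ through $A$ for which $\ell\cap K$ is a (bounded) segment exists and equals $(a_1^{2/3}+a_2^{2/3})^{3/2}$. *)

theory Defs
  imports "HOL-Analysis.Analysis"
begin

definition orthant :: "(real ^ 'n) set" where
  "orthant = {x. \<forall>i. 0 \<le> x $ i}"

definition is_line :: "'a::euclidean_space set \<Rightarrow> bool" where
  "is_line l \<longleftrightarrow> affine l \<and> aff_dim l = 1"

(* Lines meeting K in an unbounded set contribute nothing, since a closed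
   segment is bounded; the length of a segment is the distance between its
   endpoints, which are determined by the segment up to order. *)
definition cut_segment_lengths :: "'a::euclidean_space set \<Rightarrow> 'a \<Rightarrow> real set" where
  "cut_segment_lengths K A =
     {dist p q | l p q. is_line l \<and> A \<in> l \<and> p \<noteq> q \<and> l \<inter> K = closed_segment p q}"

definition is_minimum :: "real set \<Rightarrow> real \<Rightarrow> bool" where
  "is_minimum S m \<longleftrightarrow> m \<in> S \<and> (\<forall>x\<in>S. m \<le> x)"

end

theory Submission
  imports Defs
begin

text \<open>
  A segment cut from the orthant has a vanishing coordinate \<open>i\<close> at one end and a vanishing
  coordinate \<open>j \<noteq> i\<close> at the other. If \<open>A\<close> divides it in the ratio \<open>u : w\<close> with \<open>u + w = 1\<close>,
  those two coordinates alone contribute \<open>(A\<^sub>i / u)\<^sup>2 + (A\<^sub>j / w)\<^sup>2\<close> to the squared length. With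
  \<open>c = A\<^sub>i powr (2/3)\<close> and \<open>d = A\<^sub>j powr (2/3)\<close> this is \<open>c\<^sup>3 / u\<^sup>2 + d\<^sup>3 / w\<^sup>2 \<ge> (c + d)\<^sup>3\<close>, with
  equality for \<open>u = c / (c + d)\<close>. The bound is smallest for the two smallest coordinates of \<open>A\<close>,
  and it is attained by moving only these two coordinates.
\<close>

text \<open>For \<open>c, s > 0\<close> the right side is the tangent to the convex function
  \<open>c ^ 3 / u\<^sup>2\<close> of \<open>u\<close> at \<open>u = c / s\<close>. Hence the gap
  times \<open>u\<^sup>2\<close> has the double root \<open>c / s\<close>, which gives the
  factorization below.\<close>

lemma cube_div_square_ge_tangent:
  fixes c s u :: real
  assumes "c \<ge> 0" "s \<ge> 0" "u > 0"
  shows "c ^ 3 / u\<^sup>2 \<ge> 3 * c * s\<^sup>2 - 2 * u * s ^ 3"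
proof -
  have "c ^ 3 - (3 * c * s\<^sup>2 - 2 * u * s ^ 3) * u\<^sup>2 = (c - u * s)\<^sup>2 * (c + 2 * (u * s))"
    by (simp add: algebra_simps power2_eq_square power3_eq_cube)
  moreover have "\<dots> \<ge> 0"
    using assms by simp
  ultimately have "(3 * c * s\<^sup>2 - 2 * u * s ^ 3) * u\<^sup>2 \<le> c ^ 3"
    by linarith
  then show ?thesis
    using assms(3) by (simp add: pos_le_divide_eq)
qed

text \<open>With \<open>s = c + d\<close> both tangents have the same slope
  \<open>- 2 * s ^ 3\<close>, so their sum depends only on \<open>u + w = 1\<close> and equals
  \<open>3 * s ^ 3 - 2 * s ^ 3\<close>.\<close>

lemma sum_cubes_div_squares_ge:
  fixes c d u w :: real
  assumes "c \<ge> 0" "d \<ge> 0" "u > 0" "w > 0" "u + w = 1"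
  shows "c ^ 3 / u\<^sup>2 + d ^ 3 / w\<^sup>2 \<ge> (c + d) ^ 3"
proof -
  have "(c + d) ^ 3 = 3 * (c + d) * (c + d)\<^sup>2 - 2 * (u + w) * (c + d) ^ 3"
    using assms(5) by (simp add: power2_eq_square power3_eq_cube)
  also have "\<dots> = (3 * c * (c + d)\<^sup>2 - 2 * u * (c + d) ^ 3)
      + (3 * d * (c + d)\<^sup>2 - 2 * w * (c + d) ^ 3)"
    by (simp add: algebra_simps)
  also have "\<dots> \<le> c ^ 3 / u\<^sup>2 + d ^ 3 / w\<^sup>2"
    using assms by (intro add_mono cube_div_square_ge_tangent) auto
  finally show ?thesis .
qed

lemma powr_two_thirds_cubed:
  fixes x :: real
  assumes "x > 0"
  shows "(x powr (2/3)) ^ 3 = x\<^sup>2"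
  using assms by (simp add: powr_powr flip: powr_numeral)

lemma powr_three_halves_eq_sqrt:
  fixes x :: real
  assumes "x > 0"
  shows "x powr (3/2) = sqrt (x ^ 3)"
  using assms by (simp add: powr_powr flip: powr_half_sqrt powr_numeral)

lemma dist_ge_two_coordinates:
  fixes p q :: "real ^ 'n"
  assumes "i \<noteq> j"
  shows "(p $ i - q $ i)\<^sup>2 + (p $ j - q $ j)\<^sup>2 \<le> (dist p q)\<^sup>2"
proof -
  have "(\<Sum>k\<in>{i, j}. (p $ k - q $ k)\<^sup>2) \<le> (\<Sum>k\<in>UNIV. (p $ k - q $ k)\<^sup>2)"
    by (intro sum_mono2) auto
  then show ?thesis
    using assms by (simp add: dist_vec_def L2_set_def dist_real_def sum_nonneg)
qed

lemma convex_orthant: "convex (orthant :: (real ^ 'n) set)"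
  by (auto simp: convex_def orthant_def)

text \<open>If all coordinates of \<open>p\<close> were positive, the line could be followed a
  little beyond \<open>p\<close>, away from \<open>q\<close>, without leaving the orthant.\<close>

lemma cut_segment_endpoint_has_zero_coordinate:
  fixes p q :: "real ^ 'n"
  assumes "affine l" "p \<noteq> q" "l \<inter> orthant = closed_segment p q"
  obtains i where "p $ i = 0"
proof -
  have pq: "p \<in> l" "q \<in> l" "p \<in> orthant" "q \<in> orthant"
    using assms(3) by auto
  have "\<exists>i. p $ i = 0"
  proof (rule ccontr)
    assume "\<not> ?thesis"
    then have pos: "p $ i > 0" for i
      using pq(3) by (metis less_eq_real_def mem_Collect_eq orthant_def)
    have q_nonneg: "q $ i \<ge> 0" for i
      using pq(4) by (simp add: orthant_def)
    \<comment> \<open>A step length with \<open>r * q $ i \<le> p $ i\<close> for all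
      \<open>i\<close>; adding 1 to the denominators keeps them positive where
      \<open>q $ i = 0\<close>.\<close>
    define r where "r = Min (range (\<lambda>i. p $ i / (q $ i + 1)))"
    have "r > 0"
      unfolding r_def using pos q_nonneg by (subst Min_gr_iff) (auto intro!: divide_pos_pos add_nonneg_pos)
    have r_le: "r * q $ i \<le> p $ i" for i
    proof -
      have "r \<le> p $ i / (q $ i + 1)"
        unfolding r_def by (intro Min_le) auto
      then have "r * (q $ i + 1) \<le> p $ i"
        using q_nonneg[of i] by (simp add: pos_le_divide_eq)
      then show ?thesis
        using \<open>r > 0\<close> by (simp add: algebra_simps)
    qed
    define x where "x = (1 + r) *\<^sub>R p + (- r) *\<^sub>R q"
    have "x \<in> l"
      unfolding x_def by (intro mem_affine[OF assms(1) pq(1,2)]) simp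
    moreover have "x \<in> orthant"
      unfolding orthant_def
    proof (intro CollectI allI)
      fix i
      have "r * p $ i > 0"
        using \<open>r > 0\<close> pos by simp
      then show "0 \<le> x $ i"
        using r_le[of i] pos[of i] by (simp add: x_def distrib_right)
    qed
    ultimately have "x \<in> closed_segment p q"
      using assms(3) by blast
    then obtain t where t: "0 \<le> t" "x = (1 - t) *\<^sub>R p + t *\<^sub>R q"
      by (auto simp: in_segment)
    \<comment> \<open>The point \<open>x\<close> is both \<open>p - r (q - p)\<close> and
      \<open>p + t (q - p)\<close>.\<close>
    have "(t + r) *\<^sub>R (q - p) = 0"
      using t(2) by (simp add: x_def algebra_simps)
    then show False
      using \<open>r > 0\<close> t(1) assms(2) by simp
  qed
  then show ?thesis
    using that by blast
qed

text \<open>The pair \<open>i\<close>, \<open>j\<close> depends on the segment, so the bound is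
  stated for some pair; comparing it with the two smallest coordinates comes later.\<close>

lemma cut_segment_length_ge:
  fixes A :: "real ^ 'n"
  assumes "x \<in> cut_segment_lengths orthant A" and pos: "\<And>i. A $ i > 0"
  obtains i j where "i \<noteq> j" "(A $ i powr (2/3) + A $ j powr (2/3)) powr (3/2) \<le> x"
proof -
  from assms(1) obtain l p q where x: "x = dist p q" and "is_line l" "A \<in> l" "p \<noteq> q"
    and seg: "l \<inter> orthant = closed_segment p q"
    by (auto simp: cut_segment_lengths_def)
  then have "affine l"
    by (simp add: is_line_def)
  obtain i where i: "p $ i = 0"
    using cut_segment_endpoint_has_zero_coordinate \<open>affine l\<close> \<open>p \<noteq> q\<close> seg by metis
  obtain j where j: "q $ j = 0"
    using cut_segment_endpoint_has_zero_coordinate \<open>affine l\<close> \<open>p \<noteq> q\<close> seg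
    by (metis closed_segment_commute)
  have "A \<in> closed_segment p q"
    using \<open>A \<in> l\<close> pos seg by (auto simp: orthant_def less_imp_le)
  then obtain u where u: "0 \<le> u" "u \<le> 1" and A: "A = (1 - u) *\<^sub>R p + u *\<^sub>R q"
    by (auto simp: in_segment)
  have Ai: "A $ i = u * q $ i" and Aj: "A $ j = (1 - u) * p $ j"
    by (simp_all add: A i j)
  have "u \<noteq> 0" "u \<noteq> 1"
    using Ai Aj pos[of i] pos[of j] by auto
  with u have "u > 0" "1 - u > 0"
    by auto
  \<comment> \<open>Otherwise \<open>q $ i = 0\<close> too, and \<open>A $ i = u * q $ i\<close>
    would vanish.\<close>
  have "i \<noteq> j"
    using Ai j pos[of i] by auto
  define c d where "c = A $ i powr (2/3)" and "d = A $ j powr (2/3)"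
  have cd: "c > 0" "d > 0"
    using pos[of i] pos[of j] by (simp_all add: c_def d_def)
  have "(c + d) ^ 3 \<le> c ^ 3 / u\<^sup>2 + d ^ 3 / (1 - u)\<^sup>2"
    using cd \<open>u > 0\<close> \<open>1 - u > 0\<close> by (intro sum_cubes_div_squares_ge) auto
  also have "\<dots> = (q $ i)\<^sup>2 + (p $ j)\<^sup>2"
    using \<open>u > 0\<close> \<open>1 - u > 0\<close> pos[of i] pos[of j]
    by (simp add: c_def d_def powr_two_thirds_cubed Ai Aj power_mult_distrib)
  also have "\<dots> \<le> (dist p q)\<^sup>2"
    using dist_ge_two_coordinates[OF \<open>i \<noteq> j\<close>, of p q] by (simp add: i j)
  finally have "sqrt ((c + d) ^ 3) \<le> x"
    by (simp add: x real_le_lsqrt)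
  then have "(c + d) powr (3/2) \<le> x"
    using cd by (simp add: powr_three_halves_eq_sqrt)
  then show ?thesis
    using that \<open>i \<noteq> j\<close> by (simp add: c_def d_def)
qed

lemma two_coordinate_cut_segment_length:
  fixes A :: "real ^ 'n"
  assumes pos: "\<And>k. A $ k > 0" and "i \<noteq> j"
  shows "(A $ i powr (2/3) + A $ j powr (2/3)) powr (3/2) \<in> cut_segment_lengths orthant A"
proof -
  define c d where "c = A $ i powr (2/3)" and "d = A $ j powr (2/3)"
  have cd: "c > 0" "d > 0"
    using pos[of i] pos[of j] by (simp_all add: c_def d_def)
  have c3: "c ^ 3 = (A $ i)\<^sup>2" and d3: "d ^ 3 = (A $ j)\<^sup>2"
    using pos[of i] pos[of j] by (simp_all add: c_def d_def powr_two_thirds_cubed)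
  \<comment> \<open>The equality case of \<open>sum_cubes_div_squares_ge\<close>.\<close>
  define u where "u = c / (c + d)"
  have u: "u > 0" "1 - u > 0" and w: "1 - u = d / (c + d)"
    using cd by (auto simp: u_def field_simps)
  \<comment> \<open>The values at \<open>i\<close> and \<open>j\<close> are forced by
    \<open>A = (1 - u) *\<^sub>R p + u *\<^sub>R q\<close> and the two zeros; elsewhere both ends
    agree with \<open>A\<close>.\<close>
  define p q :: "real ^ 'n"
    where "p = (\<chi> k. if k = i then 0 else if k = j then A $ j / (1 - u) else A $ k)"
      and "q = (\<chi> k. if k = i then A $ i / u else if k = j then 0 else A $ k)"
  have p: "p $ i = 0" "p $ j > 0" and q: "q $ i > 0" "q $ j = 0"
    using u pos[of i] pos[of j] \<open>i \<noteq> j\<close> by (auto simp: p_def q_def)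
  then have "p \<noteq> q"
    by auto
  have "p \<in> orthant" "q \<in> orthant"
    using u pos by (auto simp: p_def q_def orthant_def less_imp_le)
  then have seg_sub: "closed_segment p q \<subseteq> orthant"
    by (intro closed_segment_subset convex_orthant)
  have A: "A = (1 - u) *\<^sub>R p + u *\<^sub>R q"
    using u \<open>i \<noteq> j\<close> by (auto simp: vec_eq_iff p_def q_def simp flip: distrib_right)
  define l where "l = affine hull {p, q}"
  have "is_line l"
    using \<open>p \<noteq> q\<close> by (simp add: is_line_def l_def aff_dim_2)
  moreover have "A \<in> l"
    unfolding l_def affine_hull_2
    by (intro CollectI exI[of _ "1 - u"] exI[of _ u] conjI A) simp
  moreover have "l \<inter> orthant = closed_segment p q"
  proof
    show "closed_segment p q \<subseteq> l \<inter> orthant"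
      using seg_sub convex_hull_subset_affine_hull[of "{p, q}"]
      by (auto simp: l_def segment_convex_hull)
    show "l \<inter> orthant \<subseteq> closed_segment p q"
    proof
      fix x assume "x \<in> l \<inter> orthant"
      then obtain s t where st: "x = s *\<^sub>R p + t *\<^sub>R q" "s + t = 1" and "x \<in> orthant"
        by (auto simp: l_def affine_hull_2)
      then have "0 \<le> x $ i" "0 \<le> x $ j"
        by (auto simp: orthant_def)
      \<comment> \<open>Because of the zeros, \<open>x $ i = t * q $ i\<close> and
        \<open>x $ j = s * p $ j\<close>.\<close>
      then have "0 \<le> s" "0 \<le> t"
        using p q by (simp_all add: st(1) zero_le_mult_iff)
      moreover have "s = 1 - t"
        using st(2) by simp
      ultimately show "x \<in> closed_segment p q"
        using st(1) by (auto simp: in_segment)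
    qed
  qed
  moreover have "(c + d) powr (3/2) = dist p q"
  proof -
    have "(\<Sum>k\<in>UNIV. (p $ k - q $ k)\<^sup>2) = (\<Sum>k\<in>{i, j}. (p $ k - q $ k)\<^sup>2)"
      by (intro sum.mono_neutral_right) (auto simp: p_def q_def)
    also have "\<dots> = (A $ i)\<^sup>2 / u\<^sup>2 + (A $ j)\<^sup>2 / (1 - u)\<^sup>2"
      using \<open>i \<noteq> j\<close> by (simp add: p_def q_def power_divide)
    also have "\<dots> = c ^ 3 / u\<^sup>2 + d ^ 3 / (1 - u)\<^sup>2"
      by (simp add: c3 d3)
    also have "\<dots> = c * (c + d)\<^sup>2 + d * (c + d)\<^sup>2"
      using cd unfolding w by (simp add: u_def power_divide power3_eq_cube power2_eq_square)
    also have "\<dots> = (c + d) ^ 3"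
      by (simp add: algebra_simps power2_eq_square power3_eq_cube)
    finally show ?thesis
      using cd by (simp add: powr_three_halves_eq_sqrt dist_vec_def L2_set_def dist_real_def)
  qed
  ultimately show ?thesis
    unfolding cut_segment_lengths_def c_def d_def using \<open>p \<noteq> q\<close> by blast
qed

(* The bijection e numbers the coordinates 1, ..., n, so that A = (a 1, ..., a n). *)
theorem proposition8:
  fixes n :: nat and a :: "nat \<Rightarrow> real" and A :: "real ^ 'n" and e :: "nat \<Rightarrow> 'n"
  assumes "n \<ge> 2"
    and "bij_betw e {1..n} UNIV"
    and "\<And>i. i \<in> {1..n} \<Longrightarrow> A $ e i = a i"
    and "0 < a 1"
    and "\<And>i. i \<in> {1..<n} \<Longrightarrow> a i \<le> a (i + 1)"
  shows "is_minimum (cut_segment_lengths orthant A)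
           ((a 1 powr (2/3) + a 2 powr (2/3)) powr (3/2))"
proof -
  have mono: "a i \<le> a j" if "1 \<le> i" "i \<le> j" "j \<le> n" for i j
    using that(2,3)
  proof (induction j rule: dec_induct)
    case (step k)
    then show ?case
      using assms(5)[of k] \<open>1 \<le> i\<close> by auto
  qed simp
  have coord: "\<exists>m\<in>{1..n}. k = e m" for k
    using assms(2) by (auto simp: bij_betw_def)
  have pos: "A $ k > 0" for k
  proof -
    obtain m where "m \<in> {1..n}" "k = e m"
      using coord by blast
    then show ?thesis
      using assms(3)[of m] assms(4) mono[of 1 m] by auto
  qed
  have "e 1 \<noteq> e 2"
    using assms(1) inj_onD[OF bij_betw_imp_inj_on[OF assms(2)], of 1 2] by auto
  then have "(a 1 powr (2/3) + a 2 powr (2/3)) powr (3/2) \<in> cut_segment_lengths orthant A"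
    using two_coordinate_cut_segment_length[of A "e 1" "e 2"] pos assms(1,3) by simp
  moreover have "(a 1 powr (2/3) + a 2 powr (2/3)) powr (3/2) \<le> x"
    if x_in: "x \<in> cut_segment_lengths orthant A" for x
  proof -
    obtain k k' where "k \<noteq> k'"
      and x: "(A $ k powr (2/3) + A $ k' powr (2/3)) powr (3/2) \<le> x"
      using cut_segment_length_ge[OF x_in pos] by blast
    moreover obtain i j where ij: "i \<in> {1..n}" "j \<in> {1..n}" "k = e i" "k' = e j"
      using coord by blast
    ultimately have "i \<noteq> j"
      by auto
    \<comment> \<open>Distinct indices cannot both be 1: one that is at least 2 gives a coordinate
      of at least \<open>a 2\<close>, and the other gives at least \<open>a 1\<close>.\<close>
    with ij(1,2) have "2 \<le> i \<or> 2 \<le> j"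
      by auto
    then have "a 1 \<le> a i \<and> a 2 \<le> a j \<or> a 1 \<le> a j \<and> a 2 \<le> a i"
      using ij(1,2) mono[of 1 i] mono[of 2 j] mono[of 1 j] mono[of 2 i] by auto
    moreover have "0 < a 2"
      using assms(1,4) mono[of 1 2] by auto
    ultimately have "a 1 powr (2/3) + a 2 powr (2/3) \<le> a i powr (2/3) + a j powr (2/3)"
      using assms(4) by (smt (verit) divide_nonneg_nonneg powr_mono2)
    then have "(a 1 powr (2/3) + a 2 powr (2/3)) powr (3/2)
        \<le> (a i powr (2/3) + a j powr (2/3)) powr (3/2)"
      by (intro powr_mono2) auto
    with x show ?thesis
      using ij assms(3) by simp
  qed
  ultimately show ?thesis
    by (simp add: is_minimum_def)
qed

end
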